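(* Let $W\subset\mathbb{C}^n$ be open, let $X\subset W$ be a purely $d$-dimensional analytic subvariety with $0\in X$, and let $\tilde\nu$ be a continuous vector field on $W$ which is tangent to $X$ at the smooth points of $X$ and such that $\nu=\tilde\nu|_X$ satisfies $\mathrm{Sing}(\nu)=\{0\}$. Let $\tilde\sigma\colon W\to T^*W$ be the continuous section corresponding to $\tilde\nu$ under a Hermitian metric. Then $\tilde\sigma(W)$ intersects the conormal space $T^*_XW$ only at $(0,0)$.
   Context: $\mathrm{Sing}(\nu)$ is the zero set of $\nu$. Any Hermitian metric $h$ on $\mathbb{C}^n$ induces an $\mathbb{R}$-linear $C^\infty$ isomorphism $T\mathbb{C}^n\cong T^*\mathbb{C}^n$, and $\tilde\sigma(x)=h_x(\cdot,\tilde\nu(x))$. The conormal space $T^*_XW$ is the closure in $T^*W$ of $\{(x,\xi): x\in X_{sm},\ \xi(T_xX)=0\}$. *)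

theory Defs
  imports "HOL-Analysis.Analysis"
begin

definition holomorphic_fun_on :: "(complex^'n \<Rightarrow> complex) \<Rightarrow> (complex^'n) set \<Rightarrow> bool" where
  "holomorphic_fun_on f U \<longleftrightarrow>
     (\<forall>x\<in>U. \<exists>L. (f has_derivative L) (at x) \<and> (\<forall>c v. L (c *s v) = c * L v))"

definition holomorphic_map_on :: "(complex^'n \<Rightarrow> complex^'m) \<Rightarrow> (complex^'n) set \<Rightarrow> bool" where
  "holomorphic_map_on f U \<longleftrightarrow> (\<forall>i. holomorphic_fun_on (\<lambda>x. f x $ i) U)"

text \<open>The local equations are required near every point of \<open>W\<close>, not only near the points of
  \<open>X\<close>; this makes \<open>X\<close> closed in \<open>W\<close>.\<close>

definition analytic_subvariety :: "(complex^'n) set \<Rightarrow> (complex^'n) set \<Rightarrow> bool" where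
  "analytic_subvariety W X \<longleftrightarrow> X \<subseteq> W \<and>
     (\<forall>p\<in>W. \<exists>U F. open U \<and> p \<in> U \<and> U \<subseteq> W \<and> finite F \<and>
        (\<forall>f\<in>F. holomorphic_fun_on f U) \<and> X \<inter> U = {z\<in>U. \<forall>f\<in>F. f z = 0})"

text \<open>Points near which \<open>X\<close> is a complex submanifold of complex dimension \<open>k\<close>: a biholomorphic
  change of coordinates takes \<open>X\<close> to a complex linear subspace of dimension \<open>k\<close>.\<close>

definition smooth_points_dim :: "nat \<Rightarrow> (complex^'n) set \<Rightarrow> (complex^'n) set" where
  "smooth_points_dim k X = {x\<in>X. \<exists>U V \<phi> \<psi> L.
     open U \<and> x \<in> U \<and> open V \<and> homeomorphism U V \<phi> \<psi> \<and>
     holomorphic_map_on \<phi> U \<and> holomorphic_map_on (\<psi> :: complex^'n \<Rightarrow> complex^'n) V \<and>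
     vec.subspace L \<and> vec.dim L = k \<and> \<phi> ` (X \<inter> U) = V \<inter> L}"

definition smooth_points :: "(complex^'n) set \<Rightarrow> (complex^'n) set" where
  "smooth_points X = (\<Union>k. smooth_points_dim k X)"

text \<open>The dimension of \<open>X\<close> at \<open>x\<close> is the upper limit of the dimensions of \<open>X\<close> at smooth points
  tending to \<open>x\<close> (\<open>x\<close> itself included if it is smooth), as in Chirka's
  \<^emph>\<open>Complex Analytic Sets\<close>. It is written as a relation so that no value has to be
  assigned to an empty upper limit.\<close>

definition has_local_dim :: "(complex^'n) set \<Rightarrow> complex^'n \<Rightarrow> nat \<Rightarrow> bool" where
  "has_local_dim X x d \<longleftrightarrow> x \<in> closure (smooth_points_dim d X) \<and>
     (\<forall>k. x \<in> closure (smooth_points_dim k X) \<longrightarrow> k \<le> d)"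

definition purely_dimensional :: "nat \<Rightarrow> (complex^'n) set \<Rightarrow> bool" where
  "purely_dimensional d X \<longleftrightarrow> (\<forall>x\<in>X. has_local_dim X x d)"

text \<open>Velocities at \<open>x\<close> of curves in \<open>X\<close>. Only used at smooth points of \<open>X\<close>, where they form
  the tangent space of the submanifold, a complex subspace of \<open>complex^'n\<close>.\<close>

definition tangent_space :: "(complex^'n) set \<Rightarrow> complex^'n \<Rightarrow> (complex^'n) set" where
  "tangent_space X x = {v. \<exists>\<gamma> :: real \<Rightarrow> complex^'n. \<gamma> 0 = x \<and>
     (\<forall>\<^sub>F t in nhds 0. \<gamma> t \<in> X) \<and> (\<gamma> has_vector_derivative v) (at 0)}"

text \<open>Covectors are the complex linear functionals. They are represented inside the real normed
  space of real linear maps \<open>complex^'n \<Rightarrow>\<^sub>L complex\<close>, which provides the topology.\<close>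

definition covectors :: "((complex^'n) \<Rightarrow>\<^sub>L complex) set" where
  "covectors = {\<xi>. \<forall>c v. blinfun_apply \<xi> (c *s v) = c * blinfun_apply \<xi> v}"

definition cotangent_bundle ::
  "(complex^'n) set \<Rightarrow> ((complex^'n) \<times> ((complex^'n) \<Rightarrow>\<^sub>L complex)) set" where
  "cotangent_bundle W = W \<times> covectors"

definition conormal_space :: "(complex^'n) set \<Rightarrow> (complex^'n) set \<Rightarrow>
    ((complex^'n) \<times> ((complex^'n) \<Rightarrow>\<^sub>L complex)) set" where
  "conormal_space W X = top_of_set (cotangent_bundle W) closure_of
     {(x, \<xi>). x \<in> smooth_points X \<and> \<xi> \<in> covectors \<and>
        (\<forall>v\<in>tangent_space X x. blinfun_apply \<xi> v = 0)}"

fun Ck_fun :: "nat \<Rightarrow> ('a::real_normed_vector \<Rightarrow> 'b::real_normed_vector) \<Rightarrow> bool" where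
  "Ck_fun 0 f \<longleftrightarrow> continuous_on UNIV f"
| "Ck_fun (Suc k) f \<longleftrightarrow> (\<forall>x. f differentiable (at x)) \<and>
     (\<forall>v. Ck_fun k (\<lambda>x. frechet_derivative f (at x) v))"

definition Cinf_fun :: "('a::real_normed_vector \<Rightarrow> 'b::real_normed_vector) \<Rightarrow> bool" where
  "Cinf_fun f \<longleftrightarrow> (\<forall>k. Ck_fun k f)"

text \<open>Hermitian forms are complex linear in the first argument, so that \<open>h x (\<cdot>) w\<close> is a covector.\<close>

definition hermitian_form :: "(complex^'n \<Rightarrow> complex^'n \<Rightarrow> complex) \<Rightarrow> bool" where
  "hermitian_form b \<longleftrightarrow> (\<forall>u v w. b (u + v) w = b u w + b v w) \<and>
     (\<forall>c v w. b (c *s v) w = c * b v w) \<and> (\<forall>v w. b w v = cnj (b v w))"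

definition hermitian_metric :: "(complex^'n \<Rightarrow> complex^'n \<Rightarrow> complex^'n \<Rightarrow> complex) \<Rightarrow> bool" where
  "hermitian_metric h \<longleftrightarrow> (\<forall>x. hermitian_form (h x) \<and> (\<forall>v. v \<noteq> 0 \<longrightarrow> Re (h x v v) > 0)) \<and>
     (\<forall>v w. Cinf_fun (\<lambda>x. h x v w))"

definition dual_section :: "(complex^'n \<Rightarrow> complex^'n \<Rightarrow> complex^'n \<Rightarrow> complex) \<Rightarrow>
    (complex^'n \<Rightarrow> complex^'n) \<Rightarrow> complex^'n \<Rightarrow> (complex^'n) \<times> ((complex^'n) \<Rightarrow>\<^sub>L complex)" where
  "dual_section h \<nu> x = (x, Blinfun (\<lambda>v. h x v (\<nu> x)))"

lemma dual_section_apply: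
  fixes h :: "complex^'n \<Rightarrow> complex^'n \<Rightarrow> complex^'n \<Rightarrow> complex"
  assumes "hermitian_metric h"
  shows "blinfun_apply (snd (dual_section h \<nu> x)) v = h x v (\<nu> x)"
proof -
  have add: "h x (u + v) w = h x u w + h x v w" and smult: "h x (c *s v) w = c * h x v w"
    for c u v w
    using assms unfolding hermitian_metric_def hermitian_form_def by blast+
  have scale: "r *\<^sub>R u = complex_of_real r *s u" for r and u :: "complex^'n"
    by (simp add: vec_eq_iff scaleR_conv_of_real [where 'a = complex])
  have "linear (\<lambda>v. h x v (\<nu> x))"
    by (rule linearI) (simp_all add: add smult scale scaleR_conv_of_real [where 'a = complex])
  then have "bounded_linear (\<lambda>v. h x v (\<nu> x))"
    by (simp add: linear_conv_bounded_linear)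
  then show ?thesis
    by (simp add: dual_section_def bounded_linear_Blinfun_apply)
qed

definition Sing :: "(complex^'n) set \<Rightarrow> (complex^'n \<Rightarrow> complex^'n) \<Rightarrow> (complex^'n) set" where
  "Sing X \<nu> = {x\<in>X. \<nu> x = 0}"

end

theory Submission
  imports Defs
begin

text \<open>The key is to pair covectors with \<open>\<nu>\<close>. A conormal covector at a smooth
  point \<open>y\<close> of \<open>X\<close> kills \<open>\<nu> y\<close>, because \<open>\<nu> y\<close> is tangent to \<open>X\<close>. The function
  \<open>(y, \<xi>) \<mapsto> \<xi> (\<nu> y)\<close> is continuous over \<open>W\<close>, so it vanishes on the whole conormal space
  (\<open>conormal_annihilates_field\<close>), singular points of \<open>X\<close> included. On the graph of the section
  dual to \<open>\<nu>\<close> its value is \<open>h x (\<nu> x) (\<nu> x)\<close>, which is positive unless \<open>\<nu> x = 0\<close>. Hence a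
  common point lies over a zero of \<open>\<nu>\<close>. The conormal space lies over \<open>X\<close>, as \<open>X\<close> is closed in \<open>W\<close>
  (\<open>analytic_subvariety_limit_mem\<close>), so that zero belongs to \<open>Sing X \<nu>\<close> and is the origin.
  Conversely, the origin is a limit of smooth points of \<open>X\<close>, and zero covectors over these tend
  to \<open>(0, 0)\<close>.\<close>

lemma holomorphic_fun_on_imp_isCont:
  assumes "holomorphic_fun_on f U" "x \<in> U"
  shows "isCont f x"
  using assms unfolding holomorphic_fun_on_def
  by (meson has_derivative_continuous)

text \<open>A subvariety is closed in the ambient open set: near any point of \<open>W\<close> it is the common zero
  set of continuous functions.\<close>

lemma analytic_subvariety_limit_mem:
  assumes X: "analytic_subvariety W X" and "x \<in> W"
    and y: "\<And>n::nat. y n \<in> X" and lim: "y \<longlonglongrightarrow> x"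
  shows "x \<in> X"
proof -
  obtain U F where U: "open U" "x \<in> U"
    and hol: "\<forall>f\<in>F. holomorphic_fun_on f U" and eq: "X \<inter> U = {z\<in>U. \<forall>f\<in>F. f z = 0}"
    using X \<open>x \<in> W\<close> unfolding analytic_subvariety_def by meson
  have "f x = 0" if "f \<in> F" for f
  proof -
    have "isCont f x"
      using holomorphic_fun_on_imp_isCont hol that U(2) by blast
    then have "(\<lambda>n. f (y n)) \<longlonglongrightarrow> f x"
      using lim by (rule isCont_tendsto_compose)
    moreover have "\<forall>\<^sub>F n in sequentially. y n \<in> U"
      using lim U by (rule topological_tendstoD)
    then have "\<forall>\<^sub>F n in sequentially. f (y n) = 0"
      by (rule eventually_mono) (use y eq that in blast)
    then have "(\<lambda>n. f (y n)) \<longlonglongrightarrow> 0"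
      by (rule tendsto_eventually)
    ultimately show "f x = 0"
      by (rule LIMSEQ_unique)
  qed
  then show ?thesis
    using eq U(2) by blast
qed

lemma smooth_points_subset: "smooth_points X \<subseteq> X"
  unfolding smooth_points_def smooth_points_dim_def by blast

lemma conormal_space_sequentially:
  assumes "X \<subseteq> W"
  shows "(x, \<xi>) \<in> conormal_space W X \<longleftrightarrow> x \<in> W \<and> \<xi> \<in> covectors \<and>
    (\<exists>y \<eta>. (\<forall>n::nat. y n \<in> smooth_points X \<and> \<eta> n \<in> covectors \<and>
        (\<forall>v\<in>tangent_space X (y n). blinfun_apply (\<eta> n) v = 0)) \<and>
      y \<longlonglongrightarrow> x \<and> \<eta> \<longlonglongrightarrow> \<xi>)"
    (is "_ \<longleftrightarrow> _ \<and> _ \<and> ?lim")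
proof -
  let ?N = "{(x, \<xi>). x \<in> smooth_points X \<and> \<xi> \<in> covectors \<and>
        (\<forall>v\<in>tangent_space X x. blinfun_apply \<xi> v = 0)}"
  have "?N \<subseteq> cotangent_bundle W"
    using assms smooth_points_subset unfolding cotangent_bundle_def by blast
  then have "conormal_space W X = cotangent_bundle W \<inter> closure ?N"
    unfolding conormal_space_def by (simp add: closure_of_subtopology Int_absorb1)
  moreover have "(x, \<xi>) \<in> closure ?N \<longleftrightarrow> ?lim"
  proof
    assume "(x, \<xi>) \<in> closure ?N"
    then obtain s where s: "\<And>n. s n \<in> ?N" "s \<longlonglongrightarrow> (x, \<xi>)"
      unfolding closure_sequential by blast
    have "(\<lambda>n. fst (s n)) \<longlonglongrightarrow> x" "(\<lambda>n. snd (s n)) \<longlonglongrightarrow> \<xi>"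
      using tendsto_fst[OF s(2)] tendsto_snd[OF s(2)] by simp_all
    then show ?lim
      using s(1)
      by (intro exI[of _ "\<lambda>n. fst (s n)"] exI[of _ "\<lambda>n. snd (s n)"])
        (simp add: case_prod_beta)
  next
    assume ?lim
    then obtain y \<eta> where "\<forall>n. (y n, \<eta> n) \<in> ?N" "y \<longlonglongrightarrow> x" "\<eta> \<longlonglongrightarrow> \<xi>"
      by auto
    then show "(x, \<xi>) \<in> closure ?N"
      unfolding closure_sequential
      by (intro exI[of _ "\<lambda>n. (y n, \<eta> n)"]) (auto intro: tendsto_Pair)
  qed
  ultimately show ?thesis
    by (simp add: cotangent_bundle_def)
qed

text \<open>At singular points of \<open>X\<close> this is the replacement for tangency: the relation \<open>\<xi> (\<nu> x) = 0\<close>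
  is closed, so it passes from the smooth points to the limits.\<close>

lemma conormal_annihilates_field:
  assumes "X \<subseteq> W" and cont: "continuous_on W \<nu>"
    and tangent: "\<forall>x\<in>smooth_points X. \<nu> x \<in> tangent_space X x"
    and "(x, \<xi>) \<in> conormal_space W X"
  shows "blinfun_apply \<xi> (\<nu> x) = 0"
proof -
  obtain y \<eta> where "x \<in> W" and y: "\<And>n. y n \<in> smooth_points X"
    and \<eta>: "\<And>n v. v \<in> tangent_space X (y n) \<Longrightarrow> blinfun_apply (\<eta> n) v = 0"
    and lim: "y \<longlonglongrightarrow> x" "\<eta> \<longlonglongrightarrow> \<xi>"
    using assms(4) unfolding conormal_space_sequentially[OF \<open>X \<subseteq> W\<close>] by blast
  have "y n \<in> W" for n
    using y smooth_points_subset \<open>X \<subseteq> W\<close> by blast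
  then have "(\<lambda>n. \<nu> (y n)) \<longlonglongrightarrow> \<nu> x"
    using continuous_on_tendsto_compose[OF cont lim(1) \<open>x \<in> W\<close>] by simp
  then have "(\<lambda>n. blinfun_apply (\<eta> n) (\<nu> (y n))) \<longlonglongrightarrow> blinfun_apply \<xi> (\<nu> x)"
    by (rule blinfun.tendsto[OF lim(2)])
  moreover have "blinfun_apply (\<eta> n) (\<nu> (y n)) = 0" for n
    using \<eta> y tangent by blast
  ultimately show ?thesis
    by (simp add: LIMSEQ_const_iff)
qed

lemma conormal_base_mem:
  assumes "analytic_subvariety W X" and "(x, \<xi>) \<in> conormal_space W X"
  shows "x \<in> X"
proof -
  have "X \<subseteq> W"
    using assms(1) unfolding analytic_subvariety_def by blast
  obtain y where "x \<in> W" "\<And>n. y n \<in> smooth_points X" "y \<longlonglongrightarrow> x"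
    using assms(2) unfolding conormal_space_sequentially[OF \<open>X \<subseteq> W\<close>] by blast
  then show ?thesis
    using smooth_points_subset
    by (intro analytic_subvariety_limit_mem[OF assms(1), of x y]) blast+
qed

lemma zero_covector_mem_conormal_space:
  assumes "X \<subseteq> W" "purely_dimensional d X" "x \<in> X"
  shows "(x, 0) \<in> conormal_space W X"
proof -
  have "x \<in> closure (smooth_points_dim d X)"
    using assms unfolding purely_dimensional_def has_local_dim_def by blast
  then obtain y where "\<forall>n. y n \<in> smooth_points_dim d X" and lim: "y \<longlonglongrightarrow> x"
    unfolding closure_sequential by blast
  then have "\<forall>n. y n \<in> smooth_points X"
    unfolding smooth_points_def by blast
  moreover have "0 \<in> covectors"
    by (simp add: covectors_def)
  ultimately show ?thesis
    unfolding conormal_space_sequentially[OF \<open>X \<subseteq> W\<close>] using assms(1,3) lim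
    by (intro conjI exI[where x = y] exI[where x = "\<lambda>n. 0"]) auto
qed

lemma dual_section_at_zero:
  assumes "hermitian_metric h" and "\<nu> x = 0"
  shows "dual_section h \<nu> x = (x, 0)"
proof -
  have herm: "hermitian_form (h x)"
    using assms(1) unfolding hermitian_metric_def by blast
  have "h x v 0 = 0" for v
  proof -
    have "h x (0 *s 0) v = 0 * h x 0 v"
      using herm unfolding hermitian_form_def by blast
    moreover have "h x v 0 = cnj (h x 0 v)"
      using herm unfolding hermitian_form_def by blast
    ultimately show ?thesis
      by simp
  qed
  then have "snd (dual_section h \<nu> x) = 0"
    by (intro blinfun_eqI) (simp add: dual_section_apply[OF assms(1)] assms(2))
  then show ?thesis
    by (simp add: dual_section_def)
qed

theorem proposition3p3:
  fixes W X :: "(complex^'n) set" and d :: nat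
    and \<nu> :: "complex^'n \<Rightarrow> complex^'n"
    and h :: "complex^'n \<Rightarrow> complex^'n \<Rightarrow> complex^'n \<Rightarrow> complex"
  assumes "open W"
    and "analytic_subvariety W X"
    and "purely_dimensional d X"
    and "0 \<in> X"
    and "continuous_on W \<nu>"
    and "\<forall>x\<in>smooth_points X. \<nu> x \<in> tangent_space X x"
    and "Sing X \<nu> = {0}"
    and "hermitian_metric h"
  shows "dual_section h \<nu> ` W \<inter> conormal_space W X = {(0, 0)}"
proof -
  have "X \<subseteq> W"
    using assms(2) unfolding analytic_subvariety_def by blast
  have "\<nu> 0 = 0"
    using assms(7) unfolding Sing_def by blast
  then have section_0: "dual_section h \<nu> 0 = (0, 0)"
    using dual_section_at_zero assms(8) by blast
  have only_origin: "x = 0" if mem: "dual_section h \<nu> x \<in> conormal_space W X" for x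
  proof -
    obtain \<xi> where \<xi>: "dual_section h \<nu> x = (x, \<xi>)"
      unfolding dual_section_def by blast
    have "blinfun_apply \<xi> (\<nu> x) = 0"
      using conormal_annihilates_field[OF \<open>X \<subseteq> W\<close> assms(5,6)] mem \<xi> by simp
    then have "h x (\<nu> x) (\<nu> x) = 0"
      using dual_section_apply[OF assms(8), of \<nu> x "\<nu> x"] \<xi> by simp
    moreover have "\<nu> x \<noteq> 0 \<longrightarrow> Re (h x (\<nu> x) (\<nu> x)) > 0"
      using assms(8) unfolding hermitian_metric_def by blast
    ultimately have "\<nu> x = 0"
      by auto
    moreover have "x \<in> X"
      using conormal_base_mem[OF assms(2)] mem \<xi> by simp
    ultimately show "x = 0"
      using assms(7) unfolding Sing_def by blast
  qed
  have "dual_section h \<nu> ` W \<inter> conormal_space W X \<subseteq> {(0, 0)}"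
  proof
    fix p assume p: "p \<in> dual_section h \<nu> ` W \<inter> conormal_space W X"
    then obtain x where x: "p = dual_section h \<nu> x"
      by blast
    then have "x = 0"
      using only_origin p by blast
    then show "p \<in> {(0, 0)}"
      using x section_0 by simp
  qed
  moreover have "(0, 0) \<in> conormal_space W X"
    using zero_covector_mem_conormal_space[OF \<open>X \<subseteq> W\<close> assms(3,4)] .
  moreover have "(0, 0) \<in> dual_section h \<nu> ` W"
    using section_0 \<open>X \<subseteq> W\<close> assms(4) by (metis image_eqI subsetD)
  ultimately show ?thesis
    by blast
qed

end
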